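(* Let $E$ be a real locally convex topological vector space with topological dual $E^*$, and let $T:E\rightrightarrows E^*$ be a set-valued map. The following are equivalent: (1) $T$ is monotone, which amounts to: for every finite subset $\{(x_i,x_i^* ) : i\in\{1,\dots,m\}\}\subset T$, $$\forall i,j\in\{1,\dots,m\},\quad \langle x_i^*-x_j^*,\,x_i-x_j\rangle\ge 0.$$ (2) For every $x^*\in E^*$, the map $\Gamma_{T-x^*}:E\rightrightarrows E$ is KKM, that is: for every $x^*\in E^*$ and for every finite subset $\{x_i : i\in\{1,\dots,m\}\}\subset D(T)$, $$\forall \bar x\in[x_1,\ldots,x_m],\ \exists i\in\{1,\dots,m\}\ \text{such that}\ \forall x_i^*\in T(x_i),\quad \langle x_i^*-x^*,\,x_i-\bar x\rangle\ge 0.$$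
   Context: A set-valued map $T:X\rightrightarrows Y$ assigns to each $x\in X$ a (possibly empty) subset $T(x)\subset Y$, and is identified with its graph $T\subset X\times Y$, so that $(x,y)\in T$ means $y\in T(x)$. Its domain is $D(T)=\{x\in X : T(x)\neq\emptyset\}$. The duality pairing between $E^*$ and $E$ is denoted $\langle\cdot,\cdot\rangle$. For $A\subset E$, $[A]$ denotes the closed convex hull of $A$, and $[x_1,\ldots,x_m]$ denotes the closed convex hull of $\{x_1,\ldots,x_m\}$. Here $m$ is a positive integer. $T:E\rightrightarrows E^*$ is monotone if $\langle y^*-x^*,y-x\rangle\ge 0$ for all $(x,x^* )\in T$ and $(y,y^* )\in T$. For $T:E\rightrightarrows E^*$ and $x^*\in E^*$, $T-x^*$ denotes the map $x\mapsto T(x)-x^*$, and $\Gamma_{T-x^*}:E\rightrightarrows E$ is defined by $$\Gamma_{T-x^*}(y)=\{x\in E : \langle y^*-x^*,y-x\rangle\ge 0\ \ \forall y^*\in T(y)\},$$ so that $\Gamma_{T-x^*}(y)=E$ when $y\notin D(T)$. A set-valued map $\Gamma:E\rightrightarrows E$ is KKM if for every finite subset $A\subset D(\Gamma)$ one has $[A]\subset\bigcup\{\Gamma(x) : x\in A\}$. *)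

theory Defs
  imports "HOL-Analysis.Analysis"
begin

section \<open>Locally convex spaces\<close>

text \<open>No separation axiom is imposed.\<close>

class real_topological_vector = real_vector + topological_ab_group_add +
  assumes tendsto_scaleR_Pair:
    "filterlim (\<lambda>p. fst p *\<^sub>R snd p) (nhds (c *\<^sub>R a)) (nhds c \<times>\<^sub>F nhds a)"

text \<open>The inner quantifiers unfold \<^const>\<open>convex\<close>, which is not available inside a class
  specification; see \<open>convex_nhds_base\<close> below.\<close>

class real_locally_convex = real_topological_vector +
  assumes convex_nhds_base_unfolded:
    "open U \<Longrightarrow> 0 \<in> U \<Longrightarrow>
      \<exists>V. open V \<and> 0 \<in> V \<and> V \<subseteq> U \<and>
        (\<forall>x\<in>V. \<forall>y\<in>V. \<forall>s\<ge>0. \<forall>t\<ge>0. s + t = 1 \<longrightarrow> s *\<^sub>R x + t *\<^sub>R y \<in> V)"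

lemma convex_nhds_base:
  fixes U :: "'a::real_locally_convex set"
  assumes "open U" "0 \<in> U"
  shows "\<exists>V. open V \<and> 0 \<in> V \<and> V \<subseteq> U \<and> convex V"
  using convex_nhds_base_unfolded[OF assms] unfolding convex_def .

instance real_normed_vector \<subseteq> real_locally_convex
proof
  fix c :: real and a :: 'a
  show "filterlim (\<lambda>p. fst p *\<^sub>R snd p) (nhds (c *\<^sub>R a)) (nhds c \<times>\<^sub>F nhds a)"
    by (intro tendsto_scaleR filterlim_fst filterlim_snd)
next
  fix U :: "'a set"
  assume "open U" "0 \<in> U"
  then obtain e where "e > 0" "ball 0 e \<subseteq> U"
    by (meson openE)
  then show "\<exists>V. open V \<and> 0 \<in> V \<and> V \<subseteq> U \<and>
      (\<forall>x\<in>V. \<forall>y\<in>V. \<forall>s\<ge>0. \<forall>t\<ge>0. s + t = 1 \<longrightarrow> s *\<^sub>R x + t *\<^sub>R y \<in> V)"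
    using convex_ball[of "0 :: 'a" e]
    by (intro exI[of _ "ball 0 e"]) (simp add: convex_def)
qed

text \<open>A closed convex hull is the least closed convex superset.\<close>

definition closed_convex_hull :: "'a::real_topological_vector set \<Rightarrow> 'a set" where
  "closed_convex_hull A = (\<lambda>S. closed S \<and> convex S) hull A"


section \<open>The topological dual\<close>

typedef (overloaded) ('a::real_topological_vector) top_dual =
  "{f :: 'a \<Rightarrow> real. linear f \<and> continuous_on UNIV f}"
  morphisms pairing Abs_top_dual
proof
  show "(\<lambda>_. 0) \<in> {f :: 'a \<Rightarrow> real. linear f \<and> continuous_on UNIV f}"
    by (auto intro: linearI)
qed

notation pairing ("\<langle>_,/ _\<rangle>")

setup_lifting type_definition_top_dual

instantiation top_dual :: (real_topological_vector) real_vector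
begin

lift_definition zero_top_dual :: "'a top_dual" is "\<lambda>_. 0"
  by (auto intro: linearI)

lift_definition plus_top_dual :: "'a top_dual \<Rightarrow> 'a top_dual \<Rightarrow> 'a top_dual"
  is "\<lambda>f g x. f x + g x"
  by (auto intro: linear_compose_add continuous_on_add)

lift_definition uminus_top_dual :: "'a top_dual \<Rightarrow> 'a top_dual" is "\<lambda>f x. - f x"
  by (auto intro!: linearI continuous_on_minus simp: linear_add linear_scale)

lift_definition minus_top_dual :: "'a top_dual \<Rightarrow> 'a top_dual \<Rightarrow> 'a top_dual"
  is "\<lambda>f g x. f x - g x"
  by (auto intro: linear_compose_sub continuous_on_diff)

lift_definition scaleR_top_dual :: "real \<Rightarrow> 'a top_dual \<Rightarrow> 'a top_dual"
  is "\<lambda>c f x. c * f x"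
  by (auto intro!: linearI continuous_on_mult_left simp: linear_add linear_scale algebra_simps)

instance
  by standard (transfer; simp add: fun_eq_iff algebra_simps)+

end


section \<open>Set-valued maps\<close>

definition graph_of :: "('a \<Rightarrow> 'b set) \<Rightarrow> ('a \<times> 'b) set" where
  "graph_of T = {(x, y). y \<in> T x}"

definition dom_of :: "('a \<Rightarrow> 'b set) \<Rightarrow> 'a set" where
  "dom_of T = {x. T x \<noteq> {}}"

definition monotone_setmap :: "('a::real_topological_vector \<Rightarrow> 'a top_dual set) \<Rightarrow> bool" where
  "monotone_setmap T \<longleftrightarrow>
    (\<forall>(x, x') \<in> graph_of T. \<forall>(y, y') \<in> graph_of T. \<langle>y' - x', y - x\<rangle> \<ge> 0)"

definition translate_map :: "('a \<Rightarrow> 'b::minus set) \<Rightarrow> 'b \<Rightarrow> 'a \<Rightarrow> 'b set" where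
  "translate_map T u = (\<lambda>x. (\<lambda>y. y - u) ` T x)"

definition Gamma_map ::
    "('a::real_topological_vector \<Rightarrow> 'a top_dual set) \<Rightarrow> 'a \<Rightarrow> 'a set" where
  "Gamma_map S y = {x. \<forall>y' \<in> S y. \<langle>y', y - x\<rangle> \<ge> 0}"

definition KKM_map :: "('a::real_topological_vector \<Rightarrow> 'a set) \<Rightarrow> bool" where
  "KKM_map G \<longleftrightarrow>
    (\<forall>A. finite A \<and> A \<subseteq> dom_of G \<longrightarrow> closed_convex_hull A \<subseteq> (\<Union>x\<in>A. G x))"

end

theory Submission
  imports Defs
begin

text \<open>
  The substance is the equivalence of monotonicity with the KKM property of all the
  maps \<open>\<Gamma>\<close> obtained by translation; the other two equivalences only trade finite sets for
  finite families.

  Suppose first that \<open>T\<close> is monotone and that a convex combination \<open>z = \<Sum> c\<^sub>i x\<^sub>i\<close> escapes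
  every \<open>\<Gamma>(x\<^sub>i)\<close>. Then there are \<open>x\<^sub>i* \<in> T(x\<^sub>i)\<close> with \<open>\<langle>x\<^sub>i* - u, x\<^sub>i - z\<rangle> < 0\<close>, and averaging these
  numbers with the weights \<open>c\<^sub>i\<close> gives a negative result. In the average \<open>u\<close> cancels, because
  \<open>\<Sum> c\<^sub>i (x\<^sub>i - z) = 0\<close>, and symmetrizing what is left gives
  \<open>1/2 \<Sum> c\<^sub>i c\<^sub>j \<langle>x\<^sub>i* - x\<^sub>j*, x\<^sub>i - x\<^sub>j\<rangle> \<ge> 0\<close>, a contradiction
  (\<open>weighted_duality_gap_nonneg\<close>, \<open>convex_hull_subset_Gamma_union\<close>).
  The passage from the convex hull to the closed convex hull is free: each \<open>\<Gamma>(x\<^sub>i)\<close> is closed,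
  hence so is their finite union, and the closed convex hull is the closure of the
  convex hull (\<open>closed_convex_hull_eq_closure\<close>). Arguing by closure, rather than
  by compactness of the convex hull of a finite set, covers spaces that are not Hausdorff, where
  the convex hull of a finite set need not be closed.

  Conversely, for \<open>(x, x*)\<close> and \<open>(y, y*)\<close> in the graph, the choice of the midpoints
  \<open>z = (x + y)/2\<close> and \<open>u = (x* + y*)/2\<close> makes both \<open>\<langle>x* - u, x - z\<rangle>\<close> and \<open>\<langle>y* - u, y - z\<rangle>\<close> equal to
  \<open>\<langle>y* - x*, y - x\<rangle>/4\<close>. Whichever of \<open>\<Gamma>(x)\<close> and \<open>\<Gamma>(y)\<close> contains \<open>z\<close>, this number is nonnegative.
\<close>

section \<open>Closed convex hulls\<close>

lemma continuous_on_scaleR_fixed: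
  "continuous_on UNIV (\<lambda>x :: 'a::real_topological_vector. s *\<^sub>R x)"
  unfolding continuous_on_def
proof (intro ballI)
  fix a :: 'a
  have "filterlim (\<lambda>x. (s, x)) (nhds s \<times>\<^sub>F nhds a) (at a)"
    by (intro filterlim_Pair tendsto_const tendsto_ident_at)
  from filterlim_compose[OF tendsto_scaleR_Pair this]
  show "((\<lambda>x. s *\<^sub>R x) \<longlongrightarrow> s *\<^sub>R a) (at a)"
    by simp
qed

lemma closure_subset_vimage_closure:
  assumes "continuous_on UNIV f" and "\<And>x. x \<in> C \<Longrightarrow> f x \<in> closure D" and "x \<in> closure C"
  shows "f x \<in> closure D"
proof -
  have "closed (f -` closure D)"
    using assms(1) by (simp add: closed_vimage)
  then have "closure C \<subseteq> f -` closure D"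
    using assms(2) by (intro closure_minimal) auto
  then show ?thesis
    using assms(3) by blast
qed

text \<open>
  Separate continuity of \<open>(x, y) \<mapsto> s x + t y\<close> suffices: first one summand, then the
  other, is allowed to leave \<open>C\<close> for its closure.
\<close>

lemma convex_closure_topological_vector:
  fixes C :: "'a::real_topological_vector set"
  assumes "convex C"
  shows "convex (closure C)"
proof (rule convexI)
  fix x y :: 'a and s t :: real
  assume x: "x \<in> closure C" and y: "y \<in> closure C" and st: "0 \<le> s" "0 \<le> t" "s + t = 1"
  have cont: "continuous_on UNIV (\<lambda>v. s *\<^sub>R v + t *\<^sub>R b)"
    "continuous_on UNIV (\<lambda>w. s *\<^sub>R b + t *\<^sub>R w)" for b :: 'a
    by (intro continuous_on_add continuous_on_const continuous_on_scaleR_fixed)+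
  have "s *\<^sub>R x + t *\<^sub>R w \<in> closure C" if "w \<in> C" for w
  proof (rule closure_subset_vimage_closure[OF cont(1) _ x])
    show "s *\<^sub>R v + t *\<^sub>R w \<in> closure C" if "v \<in> C" for v
      using convexD[OF assms that \<open>w \<in> C\<close> st] closure_subset by blast
  qed
  then show "s *\<^sub>R x + t *\<^sub>R y \<in> closure C"
    by (rule closure_subset_vimage_closure[OF cont(2) _ y])
qed

lemma closed_convex_hull_eq_closure:
  "closed_convex_hull A = closure (convex hull A)"
  unfolding closed_convex_hull_def
proof (rule hull_unique)
  show "A \<subseteq> closure (convex hull A)"
    using hull_subset closure_subset by (rule order_trans)
  show "closed (closure (convex hull A)) \<and> convex (closure (convex hull A))"
    by (simp add: convex_closure_topological_vector)
  show "closure (convex hull A) \<subseteq> S" if "A \<subseteq> S" "closed S \<and> convex S" for S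
    using that by (simp add: closure_minimal hull_minimal)
qed

section \<open>The duality pairing\<close>

lemma linear_pairing: "linear (pairing f)"
  using pairing[of f] by simp

lemma continuous_on_pairing: "continuous_on UNIV (pairing f)"
  using pairing[of f] by simp

lemma closed_pairing_halfspace: "closed {z. 0 \<le> \<langle>f, y - z\<rangle>}"
  by (simp add: linear_diff[OF linear_pairing] closed_Collect_le continuous_on_pairing)

lemma pairing_add_left: "\<langle>f + g, x\<rangle> = \<langle>f, x\<rangle> + \<langle>g, x\<rangle>"
  by transfer simp

lemma pairing_diff_left: "\<langle>f - g, x\<rangle> = \<langle>f, x\<rangle> - \<langle>g, x\<rangle>"
  by transfer simp

lemma pairing_scaleR_left: "\<langle>c *\<^sub>R f, x\<rangle> = c * \<langle>f, x\<rangle>"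
  by transfer simp

text \<open>
  The average of \<open>\<langle>f\<^sub>v, v - z\<rangle>\<close> over a convex combination with value \<open>z\<close> equals the double average
  of \<open>\<langle>f\<^sub>v, v - w\<rangle>\<close>. Swapping \<open>v\<close> and \<open>w\<close> and adding turns it into half the double
  average of \<open>\<langle>f\<^sub>v - f\<^sub>w, v - w\<rangle>\<close>, which monotonicity controls.
\<close>

lemma weighted_duality_gap_nonneg:
  fixes f :: "'a::real_topological_vector \<Rightarrow> 'a top_dual"
  assumes c: "\<And>v. v \<in> A \<Longrightarrow> 0 \<le> c v" "sum c A = 1"
    and mono: "\<And>v w. v \<in> A \<Longrightarrow> w \<in> A \<Longrightarrow> 0 \<le> \<langle>f v - f w, v - w\<rangle>"
  shows "0 \<le> (\<Sum>v\<in>A. c v * \<langle>f v, v - (\<Sum>w\<in>A. c w *\<^sub>R w)\<rangle>)" (is "0 \<le> ?S")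
proof -
  have "\<langle>f v, v - (\<Sum>w\<in>A. c w *\<^sub>R w)\<rangle> = (\<Sum>w\<in>A. c w * \<langle>f v, v - w\<rangle>)" for v
  proof -
    have "(\<Sum>w\<in>A. c w * \<langle>f v, v - w\<rangle>) = sum c A * \<langle>f v, v\<rangle> - (\<Sum>w\<in>A. c w * \<langle>f v, w\<rangle>)"
      by (simp add: linear_diff[OF linear_pairing] right_diff_distrib sum_subtractf
          sum_distrib_right)
    then show ?thesis
      by (simp add: c(2) linear_diff[OF linear_pairing] linear_sum[OF linear_pairing]
          linear_scale[OF linear_pairing])
  qed
  then have S: "?S = (\<Sum>v\<in>A. \<Sum>w\<in>A. c v * c w * \<langle>f v, v - w\<rangle>)"
    by (simp add: sum_distrib_left mult.assoc)
  also have "\<dots> = (\<Sum>v\<in>A. \<Sum>w\<in>A. c v * c w * \<langle>f w, w - v\<rangle>)"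
    by (subst sum.swap) (simp add: mult.commute mult.left_commute)
  finally have "2 * ?S = (\<Sum>v\<in>A. \<Sum>w\<in>A. c v * c w * \<langle>f v, v - w\<rangle>)
      + (\<Sum>v\<in>A. \<Sum>w\<in>A. c v * c w * \<langle>f w, w - v\<rangle>)"
    using S by linarith
  also have "\<dots> = (\<Sum>v\<in>A. \<Sum>w\<in>A. c v * c w * \<langle>f v - f w, v - w\<rangle>)"
    unfolding sum.distrib[symmetric]
    by (intro sum.cong refl)
      (simp add: pairing_diff_left linear_diff[OF linear_pairing] algebra_simps)
  also have "\<dots> \<ge> 0"
    by (intro sum_nonneg mult_nonneg_nonneg c(1) mono)
  finally show ?thesis
    by simp
qed

section \<open>The KKM property\<close>

lemma monotone_setmapD:
  assumes "monotone_setmap T" "x' \<in> T x" "y' \<in> T y"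
  shows "0 \<le> \<langle>y' - x', y - x\<rangle>"
  using assms unfolding monotone_setmap_def graph_of_def by blast

lemma mem_Gamma_translate_iff:
  "z \<in> Gamma_map (translate_map T u) x \<longleftrightarrow> (\<forall>x' \<in> T x. 0 \<le> \<langle>x' - u, x - z\<rangle>)"
  by (simp add: Gamma_map_def translate_map_def)

lemma closed_Gamma: "closed (Gamma_map S y)"
proof -
  have "Gamma_map S y = (\<Inter>y'\<in>S y. {z. 0 \<le> \<langle>y', y - z\<rangle>})"
    by (auto simp: Gamma_map_def)
  then show ?thesis
    by (simp add: closed_INT closed_pairing_halfspace)
qed

text \<open>
  No value \<open>\<Gamma>(y)\<close> is empty, since it contains \<open>y\<close>. Hence the KKM condition ranges over all finite
  sets, also over those that leave the domain of the given set-valued map.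
\<close>

lemma dom_of_Gamma: "dom_of (Gamma_map S) = UNIV"
proof -
  have "y \<in> Gamma_map S y" for y
    by (simp add: Gamma_map_def linear_0[OF linear_pairing])
  then show ?thesis
    by (auto simp: dom_of_def)
qed

lemma KKM_Gamma_iff:
  "KKM_map (Gamma_map S) \<longleftrightarrow>
    (\<forall>A. finite A \<longrightarrow> closed_convex_hull A \<subseteq> (\<Union>x\<in>A. Gamma_map S x))"
  by (simp add: KKM_map_def dom_of_Gamma)

lemma convex_hull_subset_Gamma_union:
  assumes "monotone_setmap T" and "finite A"
  shows "convex hull A \<subseteq> (\<Union>x\<in>A. Gamma_map (translate_map T u) x)"
proof
  fix z assume "z \<in> convex hull A"
  then obtain c where c: "\<And>v. v \<in> A \<Longrightarrow> 0 \<le> c v" "sum c A = 1" and z: "(\<Sum>v\<in>A. c v *\<^sub>R v) = z"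
    using assms(2) by (auto simp: convex_hull_finite)
  show "z \<in> (\<Union>x\<in>A. Gamma_map (translate_map T u) x)"
  proof (rule ccontr)
    assume "\<not> ?thesis"
    then have "\<forall>x\<in>A. \<exists>x'. x' \<in> T x \<and> \<langle>x' - u, x - z\<rangle> < 0"
      by (auto simp: mem_Gamma_translate_iff not_le)
    then obtain f where f: "\<And>x. x \<in> A \<Longrightarrow> f x \<in> T x"
        "\<And>x. x \<in> A \<Longrightarrow> \<langle>f x - u, x - z\<rangle> < 0"
      by metis
    have "(\<Sum>v\<in>A. c v * \<langle>u, v - z\<rangle>) = \<langle>u, \<Sum>v\<in>A. c v *\<^sub>R v\<rangle> - sum c A * \<langle>u, z\<rangle>"
      by (simp add: linear_diff[OF linear_pairing] linear_sum[OF linear_pairing]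
          linear_scale[OF linear_pairing] right_diff_distrib sum_subtractf sum_distrib_right)
    then have u: "(\<Sum>v\<in>A. c v * \<langle>u, v - z\<rangle>) = 0"
      by (simp add: z c(2))
    have "0 \<le> (\<Sum>v\<in>A. c v * \<langle>f v, v - z\<rangle>)"
      using weighted_duality_gap_nonneg[of A c f] c monotone_setmapD[OF assms(1)] f(1)
      by (simp add: z)
    also have "\<dots> = (\<Sum>v\<in>A. c v * \<langle>f v - u, v - z\<rangle>)"
      using u by (simp add: pairing_diff_left right_diff_distrib sum_subtractf)
    finally have nonneg: "0 \<le> (\<Sum>v\<in>A. c v * \<langle>f v - u, v - z\<rangle>)" .
    \<comment> \<open>The weights sum to 1, so one of them is positive and makes the average strictly negative.\<close>
    obtain v where v: "v \<in> A" "0 < c v"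
      using c by (metis less_eq_real_def sum.neutral zero_neq_one)
    have "(\<Sum>v\<in>A. c v * \<langle>f v - u, v - z\<rangle>) < (\<Sum>v\<in>A. 0)"
      using assms(2) v c(1) f(2)
      by (intro sum_strict_mono_ex1)
        (auto simp: mult_nonneg_nonpos mult_pos_neg less_imp_le intro!: bexI[of _ v])
    with nonneg show False
      by simp
  qed
qed

lemma monotone_imp_KKM_Gamma:
  fixes T :: "'a::real_topological_vector \<Rightarrow> 'a top_dual set"
  assumes "monotone_setmap T"
  shows "KKM_map (Gamma_map (translate_map T u))"
  unfolding KKM_Gamma_iff
proof (intro allI impI)
  fix A :: "'a set" assume "finite A"
  then show "closed_convex_hull A \<subseteq> (\<Union>x\<in>A. Gamma_map (translate_map T u) x)"
    unfolding closed_convex_hull_eq_closure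
    by (intro closure_minimal convex_hull_subset_Gamma_union[OF assms] closed_UN)
      (auto simp: closed_Gamma)
qed

text \<open>
  With both midpoints, \<open>x - z = -(y - z) = (x - y)/2\<close> and \<open>x' - u = -(y' - u) = (x' - y')/2\<close>,
  so the two alternatives offered by the KKM property are the same inequality.
\<close>

lemma KKM_Gamma_imp_monotone:
  fixes T :: "'a::real_topological_vector \<Rightarrow> 'a top_dual set"
  assumes "\<And>u. KKM_map (Gamma_map (translate_map T u))"
  shows "monotone_setmap T"
proof -
  have "0 \<le> \<langle>y' - x', y - x\<rangle>" if x': "x' \<in> T x" and y': "y' \<in> T y" for x x' y y'
  proof -
    define z where "z = (1/2) *\<^sub>R x + (1/2) *\<^sub>R y"
    define u where "u = (1/2) *\<^sub>R x' + (1/2) *\<^sub>R y'"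
    have "z \<in> convex hull {x, y}"
      unfolding z_def by (intro convexD[OF convex_convex_hull]) (auto intro: hull_inc)
    then have "z \<in> closed_convex_hull {x, y}"
      unfolding closed_convex_hull_eq_closure using closure_subset by blast
    moreover have "closed_convex_hull {x, y} \<subseteq> (\<Union>v\<in>{x, y}. Gamma_map (translate_map T u) v)"
      using assms[of u] by (simp only: KKM_Gamma_iff finite.intros simp_thms)
    ultimately have "z \<in> (\<Union>v\<in>{x, y}. Gamma_map (translate_map T u) v)"
      by (rule subsetD[rotated])
    then have "0 \<le> \<langle>x' - u, x - z\<rangle> \<or> 0 \<le> \<langle>y' - u, y - z\<rangle>"
      using x' y' by (auto simp: mem_Gamma_translate_iff)
    moreover have "4 * \<langle>x' - u, x - z\<rangle> = \<langle>y' - x', y - x\<rangle>"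
        "4 * \<langle>y' - u, y - z\<rangle> = \<langle>y' - x', y - x\<rangle>"
      by (simp_all add: z_def u_def pairing_diff_left pairing_add_left pairing_scaleR_left
          linear_diff[OF linear_pairing] linear_add[OF linear_pairing]
          linear_scale[OF linear_pairing] field_simps)
    ultimately show ?thesis
      by linarith
  qed
  then show ?thesis
    by (auto simp: monotone_setmap_def graph_of_def)
qed

section \<open>Finite families\<close>

lemma monotone_setmap_iff_families:
  "monotone_setmap T \<longleftrightarrow>
    (\<forall>m \<ge> (1::nat). \<forall>x x'. (\<lambda>i. (x i, x' i)) ` {1..m} \<subseteq> graph_of T \<longrightarrow>
      (\<forall>i\<in>{1..m}. \<forall>j\<in>{1..m}. \<langle>x' i - x' j, x i - x j\<rangle> \<ge> 0))" (is "_ \<longleftrightarrow> ?fam")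
proof
  assume mono: "monotone_setmap T"
  show ?fam
  proof (intro allI impI ballI)
    fix m :: nat and x x' i j
    assume "(\<lambda>i. (x i, x' i)) ` {1..m} \<subseteq> graph_of T" and ij: "i \<in> {1..m}" "j \<in> {1..m}"
    then have "(x i, x' i) \<in> graph_of T" "(x j, x' j) \<in> graph_of T"
      by blast+
    then have "x' i \<in> T (x i)" "x' j \<in> T (x j)"
      by (simp_all add: graph_of_def)
    then show "\<langle>x' i - x' j, x i - x j\<rangle> \<ge> 0"
      by (intro monotone_setmapD[OF mono])
  qed
next
  assume fam: ?fam
  have "0 \<le> \<langle>y' - x', y - x\<rangle>" if "x' \<in> T x" and "y' \<in> T y" for x x' y y'
  proof -
    define a where "a = (\<lambda>i::nat. if i = 1 then x else y)"
    define a' where "a' = (\<lambda>i::nat. if i = 1 then x' else y')"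
    have "(\<lambda>i. (a i, a' i)) ` {1..2} \<subseteq> graph_of T"
      using that by (auto simp: graph_of_def a_def a'_def)
    then have "\<forall>i\<in>{1..2}. \<forall>j\<in>{1..2}. \<langle>a' i - a' j, a i - a j\<rangle> \<ge> 0"
      using fam by (meson one_le_numeral)
    then have "0 \<le> \<langle>a' 2 - a' 1, a 2 - a 1\<rangle>"
      by simp
    then show ?thesis
      by (simp add: a_def a'_def)
  qed
  then show "monotone_setmap T"
    by (auto simp: monotone_setmap_def graph_of_def)
qed

text \<open>
  Families in the domain of \<open>T\<close> suffice: a point \<open>x\<close> outside it has \<open>\<Gamma>(x) = E\<close>, which covers
  everything. Families of length \<open>m \<ge> 1\<close> suffice too, because the closed convex hull of the empty set
  is empty.
\<close>

lemma KKM_Gamma_translate_iff_families: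
  fixes T :: "'a::real_topological_vector \<Rightarrow> 'a top_dual set"
  shows "KKM_map (Gamma_map (translate_map T u)) \<longleftrightarrow>
    (\<forall>m \<ge> (1::nat). \<forall>x. x ` {1..m} \<subseteq> dom_of T \<longrightarrow>
      (\<forall>z \<in> closed_convex_hull (x ` {1..m}).
        \<exists>i\<in>{1..m}. \<forall>x' \<in> T (x i). \<langle>x' - u, x i - z\<rangle> \<ge> 0))" (is "_ \<longleftrightarrow> ?fam")
proof
  assume KKM: "KKM_map (Gamma_map (translate_map T u))"
  show ?fam
  proof (intro allI impI ballI)
    fix m :: nat and x :: "nat \<Rightarrow> 'a" and z
    assume "z \<in> closed_convex_hull (x ` {1..m})"
    then have "z \<in> (\<Union>v\<in>x ` {1..m}. Gamma_map (translate_map T u) v)"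
      using KKM unfolding KKM_Gamma_iff by blast
    then show "\<exists>i\<in>{1..m}. \<forall>x' \<in> T (x i). \<langle>x' - u, x i - z\<rangle> \<ge> 0"
      by (auto simp: mem_Gamma_translate_iff)
  qed
next
  assume fam: ?fam
  show "KKM_map (Gamma_map (translate_map T u))"
    unfolding KKM_Gamma_iff
  proof (intro allI impI subsetI)
    fix A :: "'a set" and z assume A: "finite A" and z: "z \<in> closed_convex_hull A"
    show "z \<in> (\<Union>x\<in>A. Gamma_map (translate_map T u) x)"
    proof (cases "A \<subseteq> dom_of T")
      case True
      have "A \<noteq> {}"
        using z by (auto simp: closed_convex_hull_eq_closure)
      then have card: "1 \<le> card A"
        using A by (simp add: Suc_le_eq card_gt_0_iff)
      obtain x where "bij_betw x {1..card A} A"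
        using ex_bij_betw_nat_finite_1[OF A] by blast
      then have x: "x ` {1..card A} = A"
        by (rule bij_betw_imp_surj_on)
      have "\<exists>i\<in>{1..card A}. \<forall>x' \<in> T (x i). \<langle>x' - u, x i - z\<rangle> \<ge> 0"
        using fam card True z x by metis
      then show ?thesis
        using x by (auto simp: mem_Gamma_translate_iff)
    next
      case False
      then show ?thesis
        by (auto simp: mem_Gamma_translate_iff dom_of_def)
    qed
  qed
qed

theorem theorem3:
  fixes T :: "'a::real_locally_convex \<Rightarrow> 'a top_dual set"
  shows
    "(monotone_setmap T \<longleftrightarrow>
        (\<forall>m \<ge> (1::nat). \<forall>(x :: nat \<Rightarrow> 'a) (x' :: nat \<Rightarrow> 'a top_dual).
          (\<lambda>i. (x i, x' i)) ` {1..m} \<subseteq> graph_of T \<longrightarrow>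
          (\<forall>i\<in>{1..m}. \<forall>j\<in>{1..m}. \<langle>x' i - x' j, x i - x j\<rangle> \<ge> 0)))
   \<and> ((\<forall>u :: 'a top_dual. KKM_map (Gamma_map (translate_map T u))) \<longleftrightarrow>
        (\<forall>u :: 'a top_dual. \<forall>m \<ge> (1::nat). \<forall>x :: nat \<Rightarrow> 'a.
          x ` {1..m} \<subseteq> dom_of T \<longrightarrow>
          (\<forall>z \<in> closed_convex_hull (x ` {1..m}).
            \<exists>i\<in>{1..m}. \<forall>x' \<in> T (x i). \<langle>x' - u, x i - z\<rangle> \<ge> 0)))
   \<and> (monotone_setmap T \<longleftrightarrow> (\<forall>u :: 'a top_dual. KKM_map (Gamma_map (translate_map T u))))"
proof (intro conjI)
  show "monotone_setmap T \<longleftrightarrow> (\<forall>u. KKM_map (Gamma_map (translate_map T u)))"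
    using monotone_imp_KKM_Gamma KKM_Gamma_imp_monotone by blast
qed (rule monotone_setmap_iff_families, simp only: KKM_Gamma_translate_iff_families)

end
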